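(* Let $\Psi\in\mathbb{S}_+(\mathbb{T})$ be rational and let $G(z)=(zI-A)^{-1}B$ be a filter bank with $I\in\mathrm{Range}\,\Gamma$. Suppose that $A$ is singular. Then, over the set $\{\Phi\in\mathbb{S}_+(\mathbb{T}) : \int G\Phi G^*=I\}$, minimizing $\mathcal{S}_{\mathrm{KL}}(\Psi\|\Phi)$ is equivalent to minimizing $\mathcal{S}_{\mathrm{KL0}}(\Psi\|\Phi)$; that is, an element $\Phi$ of this set minimizes $\mathcal{S}_{\mathrm{KL}}(\Psi\|\cdot)$ over the set if and only if it minimizes $\mathcal{S}_{\mathrm{KL0}}(\Psi\|\cdot)$ over the set.
   Context: $\mathbb{T}$ is the unit circle; integrals $\int$ without limits are over $\vartheta\in[-\pi,\pi)$ with respect to $d\vartheta/2\pi$, the integrand being evaluated at $z=e^{j\vartheta}$. $\mathbb{S}_+(\mathbb{T})$ is the set of spectral densities on $\mathbb{T}$ (of real-valued scalar stationary processes) that are bounded and coercive, i.e. measurable real functions $\Phi$ with $\Phi(e^{-j\vartheta})=\Phi(e^{j\vartheta})$ and $\mu\leq\Phi\leq M$ on $\mathbb{T}$ for some constants $0<\mu\leq M<\infty$ (functions equal a.e. are identified). "Rational" means being the restriction to $\mathbb{T}$ of a rational function of $z$. Filter bank: $A\in\mathbb{R}^{n\times n}$ has all eigenvalues in the open unit disc, $B\in\mathbb{R}^n$, $(A,B)$ is reachable, $n>1$. On $\mathbb{T}$, $G^*$ is the conjugate transpose of $G$. $\mathcal{Q}_n$ is the space of real symmetric $n\times n$ matrices.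 $\Gamma$ is the linear operator $\Phi\mapsto\int G\Phi G^*$ from the real linear span of $\mathbb{S}_+(\mathbb{T})$ to $\mathcal{Q}_n$, and $\mathrm{Range}\,\Gamma\subseteq\mathcal{Q}_n$ is its range. $\mathcal{S}_{\mathrm{KL}}(\Phi_1\|\Phi_2)=\int \Phi_1\log(\Phi_1/\Phi_2)-\Phi_1+\Phi_2$ and $\mathcal{S}_{\mathrm{KL0}}(\Phi_1\|\Phi_2)=\int \Phi_1\log(\Phi_1/\Phi_2)$. *)

theory Defs
  imports "HOL-Analysis.Analysis" "HOL-Computational_Algebra.Polynomial"
    "HOL-Library.Function_Algebras"
begin

text \<open>A function on the unit circle is a function on \<open>\<complex>\<close> of which only the values on the circle
  matter. All measure-theoretic notions on the circle refer to the Lebesgue measure in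
  the angle \<open>\<theta> \<in> [-\<pi>, \<pi>)\<close>.\<close>

definition circle_measurable :: "(complex \<Rightarrow> real) \<Rightarrow> bool" where
  "circle_measurable \<Phi> \<longleftrightarrow> set_borel_measurable lebesgue {-pi..<pi} (\<lambda>\<theta>. \<Phi> (cis \<theta>))"

definition ae_circle :: "(complex \<Rightarrow> bool) \<Rightarrow> bool" where
  "ae_circle P \<longleftrightarrow> (AE \<theta>\<in>{-pi..<pi} in lebesgue. P (cis \<theta>))"

definition circle_integral :: "(complex \<Rightarrow> 'b) \<Rightarrow> 'b :: {banach, second_countable_topology}" where
  "circle_integral f = (1 / (2 * pi)) *\<^sub>R (LINT \<theta>:{-pi..<pi}|lebesgue. f (cis \<theta>))"

text \<open>Spectral densities are only determined almost everywhere. We work with representatives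
  and accordingly require the defining conditions almost everywhere, so that membership
  is invariant under changes on a null set. On the circle, \<open>cnj z\<close> is the point with
  angle \<open>-\<theta>\<close>.\<close>

definition spectral_densities :: "(complex \<Rightarrow> real) set" where
  "spectral_densities = {\<Phi>. circle_measurable \<Phi> \<and>
     ae_circle (\<lambda>z. \<Phi> (cnj z) = \<Phi> z) \<and>
     (\<exists>\<mu> M. 0 < \<mu> \<and> \<mu> \<le> M \<and> ae_circle (\<lambda>z. \<mu> \<le> \<Phi> z \<and> \<Phi> z \<le> M))}"

definition rational_on_circle :: "(complex \<Rightarrow> real) \<Rightarrow> bool" where
  "rational_on_circle \<Phi> \<longleftrightarrow> (\<exists>p q :: complex poly.
     (\<forall>z\<in>sphere 0 1. poly q z \<noteq> 0) \<and>
     ae_circle (\<lambda>z. complex_of_real (\<Phi> z) = poly p z / poly q z))"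

definition complex_matrix :: "real^'n^'m \<Rightarrow> complex^'n^'m" where
  "complex_matrix A = map_matrix complex_of_real A"

definition matrix_eigenvalue :: "'a::field^'n^'n \<Rightarrow> 'a \<Rightarrow> bool" where
  "matrix_eigenvalue A c \<longleftrightarrow> (\<exists>v. v \<noteq> 0 \<and> A *v v = c *s v)"

text \<open>Reachability of the discrete-time system \<open>x(t+1) = A x(t) + B u(t)\<close>: every state can be
  reached from the origin in finite time by a suitable input.\<close>

primrec system_state :: "real^'n^'n \<Rightarrow> real^'n \<Rightarrow> (nat \<Rightarrow> real) \<Rightarrow> nat \<Rightarrow> real^'n" where
  "system_state A B u 0 = 0"
| "system_state A B u (Suc t) = A *v system_state A B u t + u t *\<^sub>R B"

definition reachable :: "real^'n^'n \<Rightarrow> real^'n \<Rightarrow> bool" where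
  "reachable A B \<longleftrightarrow> (\<forall>x. \<exists>u t. system_state A B u t = x)"

definition conj_transpose :: "complex^'n^'m \<Rightarrow> complex^'m^'n" where
  "conj_transpose M = (\<chi> i j. cnj (M $ j $ i))"

definition filter_bank :: "real^'n^'n \<Rightarrow> real^'n \<Rightarrow> complex \<Rightarrow> complex^1^'n" where
  "filter_bank A B z = matrix_inv (mat z - complex_matrix A) ** complex_matrix (columnvector B)"

text \<open>The integral of \<open>G \<Phi> G\<^sup>*\<close>. Real symmetric matrices are regarded as complex ones: for
  real \<open>A\<close> and \<open>B\<close> and for \<open>\<Phi>\<close> in the linear span of the spectral densities,
  the value has real entries and is symmetric.\<close>

definition Gamma :: "(complex \<Rightarrow> complex^1^'n) \<Rightarrow> (complex \<Rightarrow> real) \<Rightarrow> complex^'n^'n" where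
  "Gamma G \<Phi> = circle_integral (\<lambda>z. \<Phi> z *\<^sub>R (G z ** conj_transpose (G z)))"

interpretation circle_fun: vector_space "\<lambda>(c::real) (\<Phi>::complex \<Rightarrow> real) z. c * \<Phi> z"
  by standard (auto simp: fun_eq_iff algebra_simps)

definition range_Gamma :: "(complex \<Rightarrow> complex^1^'n) \<Rightarrow> (complex^'n^'n) set" where
  "range_Gamma G = Gamma G ` circle_fun.span spectral_densities"

definition S_KL :: "(complex \<Rightarrow> real) \<Rightarrow> (complex \<Rightarrow> real) \<Rightarrow> real" where
  "S_KL \<Phi>1 \<Phi>2 = circle_integral (\<lambda>z. \<Phi>1 z * ln (\<Phi>1 z / \<Phi>2 z) - \<Phi>1 z + \<Phi>2 z)"

definition S_KL0 :: "(complex \<Rightarrow> real) \<Rightarrow> (complex \<Rightarrow> real) \<Rightarrow> real" where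
  "S_KL0 \<Phi>1 \<Phi>2 = circle_integral (\<lambda>z. \<Phi>1 z * ln (\<Phi>1 z / \<Phi>2 z))"

definition feasible :: "(complex \<Rightarrow> complex^1^'n) \<Rightarrow> (complex \<Rightarrow> real) set" where
  "feasible G = {\<Phi> \<in> spectral_densities. Gamma G \<Phi> = mat 1}"

end

theory Submission
  imports Defs
begin

text \<open>A left null vector \<open>v\<close> of \<open>A\<close> satisfies \<open>v\<^sup>T G(z) = v\<^sup>T B / z\<close>, and reachability forces
  \<open>v\<^sup>T B \<noteq> 0\<close>. Evaluating the quadratic form of the constraint \<open>\<integral> G \<Phi> G\<^sup>* = I\<close> at \<open>v\<close> therefore
  fixes the zeroth moment \<open>\<integral> \<Phi> = \<parallel>v\<parallel>\<^sup>2 / (v\<^sup>T B)\<^sup>2\<close>, so the two functionals differ by a constant on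
  the feasible set.\<close>

section \<open>Integration on the circle\<close>

text \<open>The Bochner integral is \<open>0\<close> by convention for non-integrable functions, so
  additivity of \<open>circle_integral\<close> can fail for them; this predicate records what
  splitting an integral requires.\<close>

definition circle_integrable :: "(complex \<Rightarrow> 'b :: {banach, second_countable_topology}) \<Rightarrow> bool" where
  "circle_integrable f \<longleftrightarrow> set_integrable lebesgue {-pi..<pi} (\<lambda>\<theta>. f (cis \<theta>))"

lemma circle_integral_add:
  assumes "circle_integrable f" "circle_integrable g"
  shows "circle_integral (\<lambda>z. f z + g z) = circle_integral f + circle_integral g"
  using assms unfolding circle_integrable_def circle_integral_def
  by (simp add: set_integral_add scaleR_add_right)

lemma circle_integral_diff:
  assumes "circle_integrable f" "circle_integrable g"
  shows "circle_integral (\<lambda>z. f z - g z) = circle_integral f - circle_integral g"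
  using assms unfolding circle_integrable_def circle_integral_def
  by (simp add: set_integral_diff scaleR_diff_right)

lemma circle_integrable_diff:
  assumes "circle_integrable f" "circle_integrable g"
  shows "circle_integrable (\<lambda>z. f z - g z)"
  using assms unfolding circle_integrable_def by (rule set_integral_diff)

lemma circle_integral_bounded_linear:
  assumes "bounded_linear L" "circle_integrable f"
  shows "circle_integral (\<lambda>z. L (f z)) = L (circle_integral f)"
proof -
  interpret bounded_linear L by fact
  have "(LINT \<theta>:{-pi..<pi}|lebesgue. L (f (cis \<theta>))) = L (LINT \<theta>:{-pi..<pi}|lebesgue. f (cis \<theta>))"
    using integral_bounded_linear[OF assms(1) assms(2)[unfolded circle_integrable_def set_integrable_def]]
    by (simp add: set_lebesgue_integral_def scaleR)
  then show ?thesis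
    by (simp add: circle_integral_def scaleR)
qed

lemma circle_integral_cong:
  assumes "\<And>z. norm z = 1 \<Longrightarrow> f z = g z"
  shows "circle_integral f = circle_integral g"
  using assms by (simp add: circle_integral_def)

lemma circle_integrable_bounded:
  fixes f :: "complex \<Rightarrow> real"
  assumes "circle_measurable f" "ae_circle (\<lambda>z. \<bar>f z\<bar> \<le> C)"
  shows "circle_integrable f"
  unfolding circle_integrable_def set_integrable_def
proof (rule integrableI_bounded_set[where A = "{-pi..<pi}" and B = C])
  show "(\<lambda>\<theta>. indicator {-pi..<pi} \<theta> *\<^sub>R f (cis \<theta>)) \<in> borel_measurable lebesgue"
    using assms(1) by (simp add: circle_measurable_def set_borel_measurable_def)
  show "emeasure lebesgue {-pi..<pi} < \<infinity>"
    by (simp add: emeasure_lborel_Ico)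
  show "AE \<theta> in lebesgue. \<theta> \<in> {-pi..<pi} \<longrightarrow> norm (indicator {-pi..<pi} \<theta> *\<^sub>R f (cis \<theta>)) \<le> C"
    using assms(2) unfolding ae_circle_def by eventually_elim auto
qed auto

text \<open>Measurability is known only for the functions cut off to the interval, so the expression
  is built from these. Off the interval the leading factor makes both versions vanish.\<close>

lemma circle_measurable_mult_ln_divide:
  assumes "circle_measurable f" "circle_measurable g"
  shows "circle_measurable (\<lambda>z. f z * ln (f z / g z))"
proof -
  let ?f = "\<lambda>\<theta>. indicator {-pi..<pi} \<theta> *\<^sub>R f (cis \<theta>)"
  let ?g = "\<lambda>\<theta>. indicator {-pi..<pi} \<theta> *\<^sub>R g (cis \<theta>)"
  have [measurable]: "?f \<in> borel_measurable lebesgue" "?g \<in> borel_measurable lebesgue"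
    using assms by (simp_all add: circle_measurable_def set_borel_measurable_def)
  have "(\<lambda>\<theta>. ?f \<theta> * ln (?f \<theta> / ?g \<theta>)) \<in> borel_measurable lebesgue"
    by measurable
  also have "(\<lambda>\<theta>. ?f \<theta> * ln (?f \<theta> / ?g \<theta>)) =
      (\<lambda>\<theta>. indicator {-pi..<pi} \<theta> *\<^sub>R (f (cis \<theta>) * ln (f (cis \<theta>) / g (cis \<theta>))))"
    by (auto simp: fun_eq_iff indicator_def)
  finally show ?thesis
    by (simp add: circle_measurable_def set_borel_measurable_def)
qed

section \<open>Splitting the divergence\<close>

lemma spectral_density_integrable:
  assumes "\<Phi> \<in> spectral_densities"
  shows "circle_integrable \<Phi>"
proof -
  obtain m M where *: "circle_measurable \<Phi>" "0 < m" "ae_circle (\<lambda>z. m \<le> \<Phi> z \<and> \<Phi> z \<le> M)"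
    using assms by (auto simp: spectral_densities_def)
  have "ae_circle (\<lambda>z. \<bar>\<Phi> z\<bar> \<le> M)"
    using *(3) unfolding ae_circle_def by eventually_elim (use *(2) in auto)
  then show ?thesis
    by (rule circle_integrable_bounded[OF *(1)])
qed

text \<open>Almost everywhere both densities stay in compact subintervals of the positive axis,
  where \<open>ln\<close> is bounded; hence the integrand is essentially bounded on a set of finite
  measure.\<close>

lemma relative_entropy_integrable:
  assumes "\<Psi> \<in> spectral_densities" "\<Phi> \<in> spectral_densities"
  shows "circle_integrable (\<lambda>z. \<Psi> z * ln (\<Psi> z / \<Phi> z))"
proof -
  obtain m M where 1: "circle_measurable \<Psi>" "0 < m" "ae_circle (\<lambda>z. m \<le> \<Psi> z \<and> \<Psi> z \<le> M)"
    using assms(1) by (auto simp: spectral_densities_def)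
  obtain k K where 2: "circle_measurable \<Phi>" "0 < k" "ae_circle (\<lambda>z. k \<le> \<Phi> z \<and> \<Phi> z \<le> K)"
    using assms(2) by (auto simp: spectral_densities_def)
  \<comment> \<open>Bounds the sum of the two absolute logarithms: by monotonicity,
    \<open>ln\<close> on an interval is controlled by its values at the endpoints.\<close>
  let ?C = "max \<bar>ln m\<bar> \<bar>ln M\<bar> + max \<bar>ln k\<bar> \<bar>ln K\<bar>"
  have abs_ln: "\<bar>ln x\<bar> \<le> max \<bar>ln a\<bar> \<bar>ln b\<bar>" if "0 < a" "a \<le> x" "x \<le> b" for a b x :: real
    using ln_mono[of a x] ln_mono[of x b] that by linarith
  have bound: "\<bar>x * ln (x / y)\<bar> \<le> M * ?C"
    if "m \<le> x \<and> x \<le> M" "k \<le> y \<and> y \<le> K" for x y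
  proof -
    have "\<bar>ln (x / y)\<bar> \<le> \<bar>ln x\<bar> + \<bar>ln y\<bar>"
      using that 1(2) 2(2) by (simp add: ln_div)
    also have "\<dots> \<le> ?C"
      using abs_ln[of m x M] abs_ln[of k y K] that 1(2) 2(2) by linarith
    finally show ?thesis
      unfolding abs_mult using that 1(2) by (intro mult_mono) auto
  qed
  have "ae_circle (\<lambda>z. \<bar>\<Psi> z * ln (\<Psi> z / \<Phi> z)\<bar> \<le> M * ?C)"
    using 1(3) 2(3) unfolding ae_circle_def
    by eventually_elim (use bound in blast)
  then show ?thesis
    by (rule circle_integrable_bounded[OF circle_measurable_mult_ln_divide[OF 1(1) 2(1)]])
qed

lemma S_KL_eq_S_KL0:
  assumes "\<Psi> \<in> spectral_densities" "\<Phi> \<in> spectral_densities"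
  shows "S_KL \<Psi> \<Phi> = S_KL0 \<Psi> \<Phi> - circle_integral \<Psi> + circle_integral \<Phi>"
  unfolding S_KL_def S_KL0_def
  using relative_entropy_integrable[OF assms] assms[THEN spectral_density_integrable]
  by (simp add: circle_integral_add circle_integral_diff circle_integrable_diff)

section \<open>Left null vectors and the filter bank\<close>

text \<open>A left inverse of the transpose would transpose to a right inverse of the square matrix
  \<open>A\<close>. So the transpose has a nontrivial kernel, and its elements are the left null
  vectors of \<open>A\<close>.\<close>

lemma left_null_vector_exists:
  fixes A :: "'a::field^'n^'n"
  assumes "\<not> invertible A"
  obtains v where "v \<noteq> 0" "v v* A = 0"
proof -
  have "\<nexists>M. M ** transpose A = mat 1"
    using assms matrix_transpose_mul[of _ "transpose A"]
    by (metis invertible_right_inverse transpose_mat transpose_transpose)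
  then show ?thesis
    using that by (auto simp: matrix_left_invertible_ker)
qed

text \<open>The functional given by \<open>v\<close> annihilates the range of \<open>A\<close>. If
  it annihilated \<open>B\<close> too, all states would stay in the hyperplane orthogonal to
  \<open>v\<close>.\<close>

lemma reachable_not_orthogonal:
  fixes A :: "real^'n^'n"
  assumes "reachable A B" "v \<noteq> 0" "v v* A = 0"
  shows "v \<bullet> B \<noteq> 0"
proof
  assume B: "v \<bullet> B = 0"
  have "v \<bullet> system_state A B u t = 0" for u t
  proof (induction t)
    case (Suc t)
    have "v \<bullet> (A *v system_state A B u t) = (v v* A) \<bullet> system_state A B u t"
      by (simp add: dot_lmul_matrix)
    then show ?case
      using B assms(3) by (simp add: inner_add_right)
  qed simp
  \<comment> \<open>The state to be reached is \<open>v\<close> itself.\<close>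
  then have "v \<bullet> v = 0"
    using assms(1) unfolding reachable_def by metis
  then show False
    using assms(2) by simp
qed

lemma mat_mult_vec: "mat c *v x = c *s (x :: 'a::comm_semiring_1^'n)"
  by (simp add: vec_eq_iff matrix_vector_mult_def mat_def if_distrib [where f = "\<lambda>x. x * _"] cong: if_cong)

text \<open>A nonzero kernel vector of \<open>mat z - M\<close> would be an eigenvector for
  \<open>z\<close>.\<close>

lemma resolvent_invertible:
  fixes M :: "'a::field^'n^'n"
  assumes "\<not> matrix_eigenvalue M z"
  shows "invertible (mat z - M)"
  using assms
  by (auto simp: invertible_left_inverse matrix_left_invertible_ker matrix_eigenvalue_def
      matrix_vector_mult_diff_rdistrib mat_mult_vec)

text \<open>A left null vector of \<open>A\<close> is a left eigenvector of \<open>mat z - A\<close>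
  with eigenvalue \<open>z\<close>. Applying it to the identity \<open>(mat z - A) ** G = B\<close>
  gives the formula without computing the inverse.\<close>

lemma filter_bank_left_null_vector:
  fixes A :: "real^'n^'n"
  assumes "v v* A = 0" "\<not> matrix_eigenvalue (complex_matrix A) z" "z \<noteq> 0"
  shows "(\<Sum>i\<in>UNIV. complex_of_real (v $ i) * filter_bank A B z $ i $ 1) = complex_of_real (v \<bullet> B) / z"
proof -
  define w :: "complex^'n" where "w = (\<chi> i. complex_of_real (v $ i))"
  let ?R = "mat z - complex_matrix A"
  let ?B = "complex_matrix (columnvector B) :: complex^1^'n"
  have "(w v* complex_matrix A) $ j = complex_of_real ((v v* A) $ j)" for j
    by (simp add: vector_matrix_mult_def w_def complex_matrix_def map_matrix_def)
  then have "w v* complex_matrix A = 0"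
    using assms(1) by (simp add: vec_eq_iff)
  then have "w v* ?R = z *s w"
    by (simp add: vec_eq_iff vector_matrix_mult_def mat_def algebra_simps sum_subtractf
        if_distrib [where f = "\<lambda>x. x * _"] if_distrib [where f = "\<lambda>x. _ * x"] cong: if_cong)
  \<comment> \<open>\<open>matrix_inv\<close> is a Hilbert choice; invertibility of the resolvent
    matrix supplies the existence that makes the chosen matrix an inverse.\<close>
  moreover have "?R ** filter_bank A B z = ?B"
    using someI_ex[OF resolvent_invertible[OF assms(2), unfolded invertible_def]]
    by (simp add: filter_bank_def matrix_mul_assoc matrix_inv_def)
  ultimately have "(z *s w) v* filter_bank A B z = w v* ?B"
    by (metis vector_matrix_mul_assoc)
  then have "((z *s w) v* filter_bank A B z) $ 1 = (w v* ?B) $ 1"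
    by simp
  then have "z * (\<Sum>i\<in>UNIV. complex_of_real (v $ i) * filter_bank A B z $ i $ 1) = complex_of_real (v \<bullet> B)"
    by (simp add: vector_matrix_mult_def w_def complex_matrix_def map_matrix_def columnvector_def
        inner_vec_def sum_distrib_left mult_ac)
  then show ?thesis
    using assms(3) by (simp add: field_simps)
qed

section \<open>The constraint seen through a quadratic form\<close>

text \<open>Since \<open>v\<close> is real, the bilinear and the Hermitian form of \<open>M\<close>
  at \<open>v\<close> coincide. Linearity in \<open>M\<close> lets the form pass through the
  matrix-valued integral \<open>Gamma\<close>.\<close>

definition quadratic_form :: "real^'n \<Rightarrow> complex^'n^'n \<Rightarrow> complex" where
  "quadratic_form v M = (\<Sum>i\<in>UNIV. \<Sum>j\<in>UNIV. complex_of_real (v $ i * v $ j) * M $ i $ j)"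

lemma bounded_linear_quadratic_form: "bounded_linear (quadratic_form v)"
  unfolding quadratic_form_def
  by (intro bounded_linear_sum bounded_linear_compose[OF bounded_linear_mult_right]
      bounded_linear_compose[OF bounded_linear_vec_nth] bounded_linear_vec_nth)

lemma quadratic_form_mat_1: "quadratic_form v (mat 1) = complex_of_real (v \<bullet> v)"
  by (simp add: quadratic_form_def mat_def inner_vec_def if_distrib [where f = "\<lambda>x. _ * x"] cong: if_cong)

text \<open>As \<open>v\<close> is real, the double sum factors into the pairing of \<open>v\<close>
  with \<open>g\<close> times its complex conjugate.\<close>

lemma quadratic_form_rank_one:
  fixes g :: "complex^1^'n"
  shows "quadratic_form v (g ** conj_transpose g) =
    complex_of_real ((cmod (\<Sum>i\<in>UNIV. complex_of_real (v $ i) * g $ i $ 1))\<^sup>2)"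
  unfolding complex_norm_square
  by (simp add: quadratic_form_def matrix_matrix_mult_def conj_transpose_def sum_product mult_ac)

lemma feasible_integrable:
  fixes G :: "complex \<Rightarrow> complex^1^'n"
  assumes "\<Phi> \<in> feasible G"
  shows "circle_integrable (\<lambda>z. \<Phi> z *\<^sub>R (G z ** conj_transpose (G z)))"
proof (rule ccontr)
  \<comment> \<open>the integral of a non-integrable function is \<open>0\<close>, hence not \<open>I\<close>\<close>
  assume "\<not> ?thesis"
  then have "Gamma G \<Phi> = 0"
    by (simp add: Gamma_def circle_integral_def circle_integrable_def set_integrable_def
        set_lebesgue_integral_def not_integrable_integral_eq)
  then have "mat 1 = (0 :: complex^'n^'n)"
    using assms by (simp add: feasible_def)
  then show False
    by (simp add: vec_eq_iff mat_def split: if_splits)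
qed

text \<open>The factor \<open>1 / z\<close> has modulus one on the circle, so the quadratic form
  turns the matrix integrand into a constant multiple of \<open>\<Phi>\<close>, and turns the
  identity matrix into \<open>v \<bullet> v\<close>.\<close>

lemma feasible_zeroth_moment:
  fixes A :: "real^'n^'n"
  assumes eig: "\<And>c. matrix_eigenvalue (complex_matrix A) c \<Longrightarrow> norm c < 1"
    and v: "v v* A = 0"
    and \<Phi>: "\<Phi> \<in> feasible (filter_bank A B)"
  shows "(v \<bullet> B)\<^sup>2 * circle_integral \<Phi> = v \<bullet> v"
proof -
  let ?G = "filter_bank A B"
  \<comment> \<open>Embedded into the complex numbers because \<open>quadratic_form\<close> is
    complex-valued; injectivity of the embedding brings the final equation back to the
    reals.\<close>
  let ?L = "\<lambda>x. complex_of_real ((v \<bullet> B)\<^sup>2 * x)"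
  have L: "bounded_linear ?L"
    by (intro bounded_linear_compose[OF bounded_linear_of_real] bounded_linear_mult_right)
  have eq: "?L (\<Phi> z) = quadratic_form v (\<Phi> z *\<^sub>R (?G z ** conj_transpose (?G z)))"
    if "norm z = 1" for z
  proof -
    \<comment> \<open>All eigenvalues lie in the open disc, so the resolvent exists at every point
      of the circle.\<close>
    have "\<not> matrix_eigenvalue (complex_matrix A) z" "z \<noteq> 0"
      using eig[of z] that by auto
    then have "quadratic_form v (?G z ** conj_transpose (?G z)) = complex_of_real ((v \<bullet> B)\<^sup>2)"
      using that
      by (simp add: quadratic_form_rank_one filter_bank_left_null_vector[OF v] norm_divide)
    then show ?thesis
      by (simp add: linear_cmul[OF bounded_linear.linear[OF bounded_linear_quadratic_form]])
        (simp add: scaleR_conv_of_real)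
  qed
  have "\<Phi> \<in> spectral_densities"
    using \<Phi> by (simp add: feasible_def)
  then have "?L (circle_integral \<Phi>) = circle_integral (\<lambda>z. ?L (\<Phi> z))"
    by (intro circle_integral_bounded_linear[symmetric] L spectral_density_integrable)
  also have "\<dots> = circle_integral (\<lambda>z. quadratic_form v (\<Phi> z *\<^sub>R (?G z ** conj_transpose (?G z))))"
    by (rule circle_integral_cong) (rule eq)
  also have "\<dots> = quadratic_form v (Gamma ?G \<Phi>)"
    unfolding Gamma_def
    by (intro circle_integral_bounded_linear bounded_linear_quadratic_form feasible_integrable \<Phi>)
  also have "\<dots> = complex_of_real (v \<bullet> v)"
    using \<Phi> by (simp add: feasible_def quadratic_form_mat_1)
  finally show ?thesis
    by (simp only: of_real_eq_iff)
qed

theorem mainTheorem2: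
  fixes A :: "real^'n^'n" and B :: "real^'n" and \<Psi> :: "complex \<Rightarrow> real"
  assumes "CARD('n) > 1"
    and "\<And>c. matrix_eigenvalue (complex_matrix A) c \<Longrightarrow> norm c < 1"
    and "reachable A B"
    and "mat 1 \<in> range_Gamma (filter_bank A B)"
    and "\<Psi> \<in> spectral_densities"
    and "rational_on_circle \<Psi>"
    and "\<not> invertible A"
  shows "\<forall>\<Phi>\<in>feasible (filter_bank A B).
           is_arg_min (S_KL \<Psi>) (\<lambda>\<Phi>. \<Phi> \<in> feasible (filter_bank A B)) \<Phi> \<longleftrightarrow>
           is_arg_min (S_KL0 \<Psi>) (\<lambda>\<Phi>. \<Phi> \<in> feasible (filter_bank A B)) \<Phi>"
proof -
  obtain v where v: "v \<noteq> 0" "v v* A = 0"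
    using left_null_vector_exists[OF assms(7)] .
  \<comment> \<open>The zeroth moment that the constraint forces on every feasible density, minus
    the zeroth moment of \<open>\<Psi>\<close>.\<close>
  define K where "K = v \<bullet> v / (v \<bullet> B)\<^sup>2 - circle_integral \<Psi>"
  have "S_KL \<Psi> \<Phi> = S_KL0 \<Psi> \<Phi> + K" if "\<Phi> \<in> feasible (filter_bank A B)" for \<Phi>
  proof -
    have "circle_integral \<Phi> = v \<bullet> v / (v \<bullet> B)\<^sup>2"
      using feasible_zeroth_moment[OF assms(2) v(2) that] reachable_not_orthogonal[OF assms(3) v]
      by (simp add: field_simps)
    moreover have "\<Phi> \<in> spectral_densities"
      using that by (simp add: feasible_def)
    ultimately show ?thesis
      using S_KL_eq_S_KL0[OF assms(5)] by (simp add: K_def)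
  qed
  \<comment> \<open>\<open>is_arg_min\<close> compares values at feasible densities only, and there
    a common additive constant preserves every strict inequality.\<close>
  then show ?thesis
    by (auto simp: is_arg_min_def)
qed

end
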